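(* Let $A\in(1,2]$. The equation $$\Phi_2(r):=\frac{A+1}{2}\left(\frac{1-r}{1+r}\right)-e^r=0$$ has a unique root $R=R_{\mathcal{C}_e,\mathcal{C}_c(A)}$ in $(0,1)$, and for every $f\in\mathcal{C}_e$ one has $$\operatorname{Re}\{T_f(z)\}>0\qquad\text{for all } z \text{ with } |z|<R.$$ Moreover, this radius is sharp: $R$ is the largest number in $(0,1]$ such that $\operatorname{Re}\{T_f(z)\}>0$ for all $|z|<R$ and every $f\in\mathcal{C}_e$.
   Context: Let $\mathbb{D}=\{z\in\mathbb{C}:|z|<1\}$. Let $\mathcal{A}$ be the class of analytic functions $f$ on $\mathbb{D}$ with $f(0)=0$ and $f'(0)=1$, and let $\mathcal{S}\subset\mathcal{A}$ be the subclass of functions that are univalent (injective) in $\mathbb{D}$. For analytic functions $f,g$ on $\mathbb{D}$, $f$ is subordinate to $g$, written $f\prec g$, if there is an analytic function $\omega$ on $\mathbb{D}$ with $\omega(0)=0$ and $|\omega(z)|<1$ for all $z\in\mathbb{D}$ (a Schwarz function) such that $f(z)=g(\omega(z))$ for all $z\in\mathbb{D}$. The class $\mathcal{C}_e$ is $$\mathcal{C}_e:=\left\{f\in\mathcal{S}:1+\frac{zf''(z)}{f'(z)}\prec e^z\right\}.$$ For $A\in(1,2]$ and $f\in\mathcal{S}$, the Avkhadiev--Wirths operator is $$T_f(z)=\frac{2}{A-1}\left[\frac{A+1}{2}\left(\frac{1+z}{1-z}\right)-1-\frac{zf''(z)}{f'(z)}\right],\qquad z\in\mathbb{D}.$$ For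 a family $\mathcal{F}\subset\mathcal{A}$, the radius of concavity $R_{\mathcal{F},\mathcal{C}_c(A)}$ of $\mathcal{F}$ is the largest number in $(0,1]$ such that $\operatorname{Re}\{T_f(z)\}>0$ for all $|z|<R_{\mathcal{F},\mathcal{C}_c(A)}$ and every $f\in\mathcal{F}$. *)

theory Defs
  imports "HOL-Analysis.Analysis"
begin

text \<open>
  Functions on the unit disc are total functions of type \<^typ>\<open>complex \<Rightarrow> complex\<close>;
  all conditions below only see their values on the open disc.
\<close>

abbreviation unit_disc :: "complex set" where
  "unit_disc \<equiv> ball 0 1"

definition class_A :: "(complex \<Rightarrow> complex) set" where
  "class_A = {f. f holomorphic_on unit_disc \<and> f 0 = 0 \<and> deriv f 0 = 1}"

definition class_S :: "(complex \<Rightarrow> complex) set" where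
  "class_S = {f \<in> class_A. inj_on f unit_disc}"

definition schwarz_function :: "(complex \<Rightarrow> complex) \<Rightarrow> bool" where
  "schwarz_function \<omega> \<longleftrightarrow>
     \<omega> holomorphic_on unit_disc \<and> \<omega> 0 = 0 \<and> (\<forall>z\<in>unit_disc. norm (\<omega> z) < 1)"

definition subordinate :: "(complex \<Rightarrow> complex) \<Rightarrow> (complex \<Rightarrow> complex) \<Rightarrow> bool"
    (infix "\<prec>\<^sub>s" 50) where
  "f \<prec>\<^sub>s g \<longleftrightarrow>
     f holomorphic_on unit_disc \<and> g holomorphic_on unit_disc \<and>
     (\<exists>\<omega>. schwarz_function \<omega> \<and> (\<forall>z\<in>unit_disc. f z = g (\<omega> z)))"

text \<open>The derivative of a function in \<^const>\<open>class_S\<close> has no zero in the disc, so the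
  quotients below are never divisions by zero there.\<close>

definition class_C_e :: "(complex \<Rightarrow> complex) set" where
  "class_C_e = {f \<in> class_S. (\<lambda>z. 1 + z * deriv (deriv f) z / deriv f z) \<prec>\<^sub>s exp}"

definition avkhadiev_wirths :: "real \<Rightarrow> (complex \<Rightarrow> complex) \<Rightarrow> complex \<Rightarrow> complex" where
  "avkhadiev_wirths A f z =
     2 / (of_real A - 1) *
       ((of_real A + 1) / 2 * ((1 + z) / (1 - z)) - 1 - z * deriv (deriv f) z / deriv f z)"

definition concave_up_to :: "(complex \<Rightarrow> complex) set \<Rightarrow> real \<Rightarrow> real \<Rightarrow> bool" where
  "concave_up_to F A R \<longleftrightarrow>
     (\<forall>f\<in>F. \<forall>z. norm z < R \<longrightarrow> Re (avkhadiev_wirths A f z) > 0)"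

definition is_radius_of_concavity :: "(complex \<Rightarrow> complex) set \<Rightarrow> real \<Rightarrow> real \<Rightarrow> bool" where
  "is_radius_of_concavity F A R \<longleftrightarrow>
     R \<in> {0<..1} \<and> concave_up_to F A R \<and>
     (\<forall>R'\<in>{0<..1}. concave_up_to F A R' \<longrightarrow> R' \<le> R)"

definition Phi2 :: "real \<Rightarrow> real \<Rightarrow> real" where
  "Phi2 A r = (A + 1) / 2 * ((1 - r) / (1 + r)) - exp r"

end

theory Submission
  imports Defs "HOL-Complex_Analysis.Conformal_Mappings"
begin

text \<open>
  For \<open>f \<in> class_C_e\<close> and \<open>\<bar>z\<bar> = r < 1\<close>, the operator is, up to the positive factor
  \<open>2 / (A - 1)\<close>, the difference of \<open>(A + 1) / 2 * (1 + z) / (1 - z)\<close> and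
  \<open>1 + z f''(z) / f'(z) = exp (\<omega> z)\<close> with a Schwarz function \<open>\<omega>\<close>.  The real part of the first term
  is at least \<open>(A + 1) / 2 * (1 - r) / (1 + r)\<close> (\<open>Re_Cayley_ge\<close>); the real part of the second is at
  most \<open>exp r\<close>, because \<open>\<bar>\<omega> z\<bar> \<le> r\<close> by the Schwarz lemma.  The difference of the two bounds is
  \<open>Phi2 A r\<close>, a strictly decreasing function that is positive at \<open>0\<close> and negative at \<open>1\<close>.  So it has
  exactly one zero \<open>R\<close>, and the real part of the operator is positive for \<open>r < R\<close>.

  Both bounds are attained together at \<open>z = -r\<close> if \<open>\<omega> z = -z\<close>.  Hence the radius is sharp
  as soon as some univalent normalised \<open>f\<close> satisfies \<open>1 + z f''(z) / f'(z) = exp (-z)\<close>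
  (\<open>extremal_function\<close>).  This equation integrates to \<open>f' = exp h\<close>, where \<open>h\<close> is the power series with
  \<open>z h'(z) = exp (-z) - 1\<close> and \<open>h(0) = 0\<close>.  On the disc \<open>\<bar>h\<bar> \<le> e / 2 < \<pi> / 2\<close>, so \<open>Re f' > 0\<close>, and
  \<open>f\<close> is injective by the Noshiro-Warschawski criterion.
\<close>

section \<open>The function Phi2\<close>

lemma Phi2_strict_antimono:
  assumes "-1 < A" "0 \<le> x" "x < y"
  shows "Phi2 A y < Phi2 A x"
proof -
  have "(1 - y) / (1 + y) < (1 - x) / (1 + x)"
    using assms by (simp add: divide_simps algebra_simps)
  hence "(A + 1) / 2 * ((1 - y) / (1 + y)) < (A + 1) / 2 * ((1 - x) / (1 + x))"
    using assms by (intro mult_strict_left_mono) auto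
  moreover have "exp x < exp y" using assms by simp
  ultimately show ?thesis unfolding Phi2_def by linarith
qed

lemma Phi2_unique_root:
  assumes "1 < A"
  shows "\<exists>!R. R \<in> {0<..<1} \<and> Phi2 A R = 0"
proof -
  have "continuous_on {0..1} (Phi2 A)"
    unfolding Phi2_def by (intro continuous_intros) auto
  moreover have at_0: "Phi2 A 0 > 0" and at_1: "Phi2 A 1 < 0"
    using assms by (auto simp: Phi2_def)
  ultimately obtain R where R: "0 \<le> R" "R \<le> 1" "Phi2 A R = 0"
    using IVT2'[of "Phi2 A" 1 0 0] by auto
  moreover from R at_0 at_1 have "R \<noteq> 0" "R \<noteq> 1" by auto
  ultimately have ex: "R \<in> {0<..<1} \<and> Phi2 A R = 0" by auto
  have "x = y" if "x \<in> {0<..<1}" "Phi2 A x = 0" "y \<in> {0<..<1}" "Phi2 A y = 0" for x y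
    using that Phi2_strict_antimono[of A x y] Phi2_strict_antimono[of A y x] assms
    by (cases x y rule: linorder_cases) auto
  with ex show ?thesis by blast
qed

section \<open>Positivity below the root\<close>

text \<open>
  The real part equals \<open>(1 - \<bar>z\<bar>\<^sup>2) / \<bar>1 - z\<bar>\<^sup>2\<close>, and \<open>\<bar>1 - z\<bar> \<le> 1 + \<bar>z\<bar>\<close>.
\<close>

lemma Re_Cayley_ge:
  fixes z :: complex
  assumes "norm z < 1"
  shows "(1 - norm z) / (1 + norm z) \<le> Re ((1 + z) / (1 - z))"
proof -
  have "z \<noteq> 1" using assms by auto
  have "(1 - norm z) / (1 + norm z) = (1 - (norm z)\<^sup>2) / (1 + norm z)\<^sup>2"
    using assms norm_ge_zero[of z]
    by (simp add: divide_simps power2_eq_square add_nonneg_eq_0_iff) (simp add: algebra_simps)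
  also have "\<dots> \<le> (1 - (norm z)\<^sup>2) / (norm (1 - z))\<^sup>2"
  proof (rule divide_left_mono)
    show "(norm (1 - z))\<^sup>2 \<le> (1 + norm z)\<^sup>2"
      using norm_triangle_ineq4[of 1 z] by (intro power_mono) auto
    show "0 \<le> 1 - (norm z)\<^sup>2" using assms by (simp add: power_le_one)
    show "0 < (1 + norm z)\<^sup>2 * (norm (1 - z))\<^sup>2"
      using \<open>z \<noteq> 1\<close> norm_ge_zero[of z] by (auto simp: zero_less_mult_iff add_nonneg_eq_0_iff)
  qed
  also have "\<dots> = Re ((1 + z) / (1 - z))"
    by (simp add: Re_divide cmod_power2) (simp add: power2_eq_square algebra_simps)
  finally show ?thesis .
qed

lemma Re_avkhadiev_wirths:
  "Re (avkhadiev_wirths A f z) = 2 / (A - 1) *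
     ((A + 1) / 2 * Re ((1 + z) / (1 - z)) - Re (1 + z * deriv (deriv f) z / deriv f z))"
proof -
  have "avkhadiev_wirths A f z = of_real (2 / (A - 1)) *
      (of_real ((A + 1) / 2) * ((1 + z) / (1 - z)) - (1 + z * deriv (deriv f) z / deriv f z))"
    by (simp add: avkhadiev_wirths_def algebra_simps)
  thus ?thesis by (simp only: times_complex.sel minus_complex.sel Re_complex_of_real Im_complex_of_real mult_zero_left diff_zero)
qed

lemma Re_exp_schwarz_le:
  assumes "schwarz_function \<omega>" "norm z < 1"
  shows "Re (exp (\<omega> z)) \<le> exp (norm z)"
proof -
  have "Re (exp (\<omega> z)) \<le> exp (norm (\<omega> z))"
    by (meson complex_Re_le_cmod norm_exp order_trans)
  also have "norm (\<omega> z) \<le> norm z"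
    using assms by (intro Schwarz_Lemma(1)) (auto simp: schwarz_function_def)
  finally show ?thesis by simp
qed

lemma Re_avkhadiev_wirths_ge:
  assumes "1 < A" "f \<in> class_C_e" "norm z < 1"
  shows "2 / (A - 1) * Phi2 A (norm z) \<le> Re (avkhadiev_wirths A f z)"
proof -
  obtain \<omega> where \<omega>: "schwarz_function \<omega>" "1 + z * deriv (deriv f) z / deriv f z = exp (\<omega> z)"
    using assms by (auto simp: class_C_e_def subordinate_def)
  have "(A + 1) / 2 * ((1 - norm z) / (1 + norm z)) \<le> (A + 1) / 2 * Re ((1 + z) / (1 - z))"
    using assms Re_Cayley_ge by (intro mult_left_mono) auto
  with Re_exp_schwarz_le[OF \<omega>(1) assms(3)]
  have "Phi2 A (norm z) \<le> (A + 1) / 2 * Re ((1 + z) / (1 - z)) - Re (exp (\<omega> z))"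
    unfolding Phi2_def by linarith
  thus ?thesis
    unfolding Re_avkhadiev_wirths \<omega>(2) using assms by (intro mult_left_mono) auto
qed

section \<open>The extremal function\<close>

text \<open>
  The Noshiro-Warschawski criterion: if \<open>f z = f w\<close>, the mean value theorem along the segment,
  applied to \<open>f / (z - w)\<close>, gives a point of the segment at which \<open>Re f' = 0\<close>.
\<close>

lemma Noshiro_Warschawski:
  assumes "convex S"
    and deriv: "\<And>z. z \<in> S \<Longrightarrow> (f has_field_derivative f' z) (at z)"
    and pos: "\<And>z. z \<in> S \<Longrightarrow> Re (f' z) > 0"
  shows "inj_on f S"
proof (rule inj_onI, rule ccontr)
  fix w z assume wz: "w \<in> S" "z \<in> S" "f w = f z" "w \<noteq> z"
  hence seg: "closed_segment w z \<subseteq> S"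
    using \<open>convex S\<close> by (simp add: closed_segment_subset)
  have "((\<lambda>u. f u / (z - w)) has_field_derivative f' u / (z - w)) (at u)"
    if "u \<in> closed_segment w z" for u
    using that seg deriv by (intro DERIV_cdivide) auto
  from complex_mvt_line[OF this] obtain u where
    u: "u \<in> closed_segment w z"
       "Re (f z / (z - w)) - Re (f w / (z - w)) = Re (f' u / (z - w) * (z - w))"
    by blast
  hence "Re (f' u) = 0" using wz by simp
  with pos[of u] u seg show False by auto
qed

text \<open>
  The power series of \<open>- Ein\<close>, where \<open>Ein\<close> is the entire exponential integral
  \<open>Ein z = \<integral>\<^sub>0\<^sup>z (1 - exp (-t)) / t dt\<close>.  The coefficient for \<open>n = 0\<close> is \<open>0\<close> because of
  \<open>1 / 0 = 0\<close>.
\<close>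

definition neg_Ein_coeff :: "nat \<Rightarrow> complex" where
  "neg_Ein_coeff n = (-1) ^ n / (of_nat n * fact n)"

definition neg_Ein :: "complex \<Rightarrow> complex" where
  "neg_Ein z = (\<Sum>n. neg_Ein_coeff n * z ^ n)"

lemma neg_Ein_0: "neg_Ein 0 = 0"
  unfolding neg_Ein_def powser_zero by (simp add: neg_Ein_coeff_def)

lemma summable_neg_Ein: "summable (\<lambda>n. neg_Ein_coeff n * z ^ n)"
proof (rule summable_comparison_test')
  show "summable (\<lambda>n. inverse (fact n) * norm z ^ n)" by (rule summable_exp)
  fix n :: nat
  have "norm (neg_Ein_coeff n) \<le> inverse (fact n)"
    by (cases "n = 0") (auto simp: neg_Ein_coeff_def norm_divide norm_mult norm_power divide_simps)
  thus "norm (neg_Ein_coeff n * z ^ n) \<le> inverse (fact n) * norm z ^ n"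
    by (simp add: norm_mult norm_power mult_right_mono)
qed

lemma neg_Ein_has_derivative:
  obtains D where "(neg_Ein has_field_derivative D) (at z)" "z * D = exp (-z) - 1"
proof
  show "(neg_Ein has_field_derivative (\<Sum>n. diffs neg_Ein_coeff n * z ^ n)) (at z)"
    unfolding neg_Ein_def [abs_def]
    by (rule termdiffs_strong_converges_everywhere) (rule summable_neg_Ein)
  have summand: "z * (diffs neg_Ein_coeff n * z ^ n) = (-z) ^ Suc n /\<^sub>R fact (Suc n)" for n
  proof -
    have "diffs neg_Ein_coeff n = (-1) ^ Suc n / fact (Suc n)"
      unfolding diffs_def neg_Ein_coeff_def
      by (simp del: of_nat_Suc fact_Suc power_Suc)
    thus ?thesis
      unfolding power_minus[of z "Suc n"]
      by (simp add: scaleR_conv_of_real divide_inverse del: fact_Suc)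
  qed
  have "(\<lambda>n. (-z) ^ Suc n /\<^sub>R fact (Suc n)) sums (exp (-z) - 1)"
    using exp_converges[of "-z"] by (subst sums_Suc_iff) simp
  moreover have "summable (\<lambda>n. diffs neg_Ein_coeff n * z ^ n)"
    by (rule termdiff_converges_all) (rule summable_neg_Ein)
  ultimately show "z * (\<Sum>n. diffs neg_Ein_coeff n * z ^ n) = exp (-z) - 1"
    by (simp add: suminf_mult[symmetric] summand sums_iff del: fact_Suc power_Suc)
qed

text \<open>
  For \<open>n \<ge> 2\<close> the coefficients are at most \<open>1 / (2 n!)\<close> in absolute value.  Summing \<open>1 / (2 n!)\<close>
  over all \<open>n\<close> gives \<open>e / 2\<close>; the correction \<open>-1/2\<close> at \<open>n = 0\<close> compensates the missing \<open>1/2\<close> at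
  \<open>n = 1\<close>.
\<close>

lemma norm_neg_Ein_le:
  assumes "norm z \<le> 1"
  shows "norm (neg_Ein z) \<le> exp 1 / 2"
proof -
  define b :: "nat \<Rightarrow> real" where
    "b n = inverse (fact n) / 2 + ((if n = 1 then 1/2 else 0) - (if n = 0 then 1/2 else 0))" for n
  have "(\<lambda>n. inverse (fact n) :: real) sums exp 1"
    using exp_converges[of "1::real"] by simp
  hence "b sums (exp 1 / 2 + (1/2 - 1/2))"
    unfolding b_def by (intro sums_add sums_diff sums_divide sums_single)
  hence b: "b sums (exp 1 / 2)" by simp
  have "norm (neg_Ein_coeff n * z ^ n) \<le> b n" for n
  proof -
    have "norm (neg_Ein_coeff n * z ^ n) \<le> norm (neg_Ein_coeff n)"
      using assms by (simp add: norm_mult norm_power mult_left_le power_le_one)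
    also have "\<dots> \<le> b n"
    proof (cases "n \<ge> 2")
      case True
      hence "norm (neg_Ein_coeff n) = 1 / (real n * fact n)"
        by (simp add: neg_Ein_coeff_def norm_divide norm_mult norm_power)
      also have "\<dots> \<le> 1 / (2 * fact n)"
        using True by (intro divide_left_mono mult_right_mono) auto
      finally show ?thesis using True by (simp add: b_def field_simps)
    next
      case False
      hence "n = 0 \<or> n = 1" by auto
      thus ?thesis by (auto simp: b_def neg_Ein_coeff_def)
    qed
    finally show ?thesis .
  qed
  hence "norm (neg_Ein z) \<le> suminf b"
    unfolding neg_Ein_def using b by (intro norm_suminf_le) (auto simp: sums_iff)
  with b show ?thesis by (simp add: sums_iff)
qed

lemma Re_exp_neg_Ein_pos:
  assumes "norm z \<le> 1"
  shows "Re (exp (neg_Ein z)) > 0"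
proof -
  have "\<bar>Im (neg_Ein z)\<bar> \<le> exp 1 / 2"
    using norm_neg_Ein_le[OF assms] abs_Im_le_cmod order_trans by blast
  also have "\<dots> < pi / 2" using exp_le pi_gt3 by linarith
  finally have "cos (Im (neg_Ein z)) > 0" by (intro cos_gt_zero_pi) auto
  thus ?thesis by (simp add: Re_exp)
qed

lemma extremal_function:
  obtains f where "f \<in> class_C_e"
    "\<And>z. z \<in> unit_disc \<Longrightarrow> 1 + z * deriv (deriv f) z / deriv f z = exp (-z)"
proof -
  define p where "p z = exp (neg_Ein z)" for z
  have p_deriv: "\<exists>D. (p has_field_derivative p z * D) (at z) \<and> z * D = exp (-z) - 1" for z
    using neg_Ein_has_derivative[of z] unfolding p_def [abs_def]
    by (metis DERIV_chain2 DERIV_exp)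
  hence "p field_differentiable at z" for z by (meson field_differentiable_def)
  hence "p holomorphic_on unit_disc"
    by (simp add: holomorphic_on_def field_differentiable_at_within)
  then obtain g where g: "\<And>z. z \<in> unit_disc \<Longrightarrow> (g has_field_derivative p z) (at z)"
    by (metis holomorphic_convex_primitive' convex_ball open_ball at_within_open)
  define f where "f z = g z - g 0" for z
  have f: "(f has_field_derivative p z) (at z)" if "z \<in> unit_disc" for z
    unfolding f_def [abs_def] using DERIV_diff[OF g[OF that] DERIV_const] by simp
  have df: "deriv f z = p z" if "z \<in> unit_disc" for z
    using f[OF that] by (rule DERIV_imp_deriv)
  have eq: "1 + z * deriv (deriv f) z / deriv f z = exp (-z)" if z: "z \<in> unit_disc" for z
  proof -
    obtain D where D: "(p has_field_derivative p z * D) (at z)" "z * D = exp (-z) - 1"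
      using p_deriv by blast
    have "(deriv f has_field_derivative p z * D) (at z)"
      using D(1) open_ball z by (rule has_field_derivative_transform_within_open) (simp add: df)
    hence "deriv (deriv f) z = p z * D" by (rule DERIV_imp_deriv)
    thus ?thesis using D(2) df[OF z] by (simp add: p_def)
  qed
  have "inj_on f unit_disc"
    using f by (rule Noshiro_Warschawski[OF convex_ball]) (auto simp: p_def Re_exp_neg_Ein_pos)
  moreover have "f holomorphic_on unit_disc"
    using f by (meson holomorphic_on_open open_ball)
  moreover have "deriv f 0 = 1" by (simp add: df p_def neg_Ein_0)
  ultimately have "f \<in> class_S" by (simp add: class_S_def class_A_def f_def)
  moreover have "(\<lambda>z. 1 + z * deriv (deriv f) z / deriv f z) \<prec>\<^sub>s exp"
    unfolding subordinate_def
  proof (intro conjI exI[of _ uminus] ballI)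
    have "(\<lambda>z. exp (-z)) holomorphic_on unit_disc" by (intro holomorphic_intros)
    thus "(\<lambda>z. 1 + z * deriv (deriv f) z / deriv f z) holomorphic_on unit_disc"
      by (rule holomorphic_transform) (simp add: eq)
    show "exp holomorphic_on unit_disc" by (intro holomorphic_intros)
    show "schwarz_function uminus"
      by (auto simp: schwarz_function_def intro!: holomorphic_intros)
  qed (rule eq)
  ultimately have "f \<in> class_C_e" by (simp add: class_C_e_def)
  thus thesis using eq that by blast
qed

section \<open>The radius of concavity\<close>

theorem theorem3p2:
  fixes A :: real
  assumes "1 < A" and "A \<le> 2"
  shows "(\<exists>!R. R \<in> {0<..<1} \<and> Phi2 A R = 0) \<and>
    (\<forall>R. R \<in> {0<..<1} \<and> Phi2 A R = 0 \<longrightarrow>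
      (\<forall>f\<in>class_C_e. \<forall>z. norm z < R \<longrightarrow> Re (avkhadiev_wirths A f z) > 0) \<and>
      is_radius_of_concavity class_C_e A R)"
proof (intro conjI allI impI)
  show "\<exists>!R. R \<in> {0<..<1} \<and> Phi2 A R = 0" using assms(1) by (rule Phi2_unique_root)
next
  fix R assume R: "R \<in> {0<..<1} \<and> Phi2 A R = 0"
  show pos: "\<forall>f\<in>class_C_e. \<forall>z. norm z < R \<longrightarrow> Re (avkhadiev_wirths A f z) > 0"
  proof (intro ballI allI impI)
    fix f and z :: complex assume f: "f \<in> class_C_e" and z: "norm z < R"
    have "Phi2 A (norm z) > 0"
      using Phi2_strict_antimono[of A "norm z" R] R z assms by simp
    hence "0 < 2 / (A - 1) * Phi2 A (norm z)" using assms by simp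
    also have "\<dots> \<le> Re (avkhadiev_wirths A f z)"
      using assms(1) f z R by (intro Re_avkhadiev_wirths_ge) auto
    finally show "Re (avkhadiev_wirths A f z) > 0" .
  qed
  have "R' \<le> R" if R': "concave_up_to class_C_e A R'" for R'
  proof (rule ccontr)
    assume "\<not> R' \<le> R"
    obtain f where f: "f \<in> class_C_e"
      "\<And>z. z \<in> unit_disc \<Longrightarrow> 1 + z * deriv (deriv f) z / deriv f z = exp (-z)"
      using extremal_function by blast
    define z :: complex where "z = of_real (-R)"
    have z: "norm z = R" using R by (simp add: z_def)
    have "Re ((1 + z) / (1 - z)) = (1 - R) / (1 + R)"
    proof -
      have "(1 + z) / (1 - z) = of_real ((1 - R) / (1 + R))" by (simp add: z_def)
      thus ?thesis by (simp only: Re_complex_of_real)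
    qed
    moreover have "Re (exp (-z)) = exp R" by (simp add: z_def Re_exp)
    ultimately have "Re (avkhadiev_wirths A f z) = 2 / (A - 1) * Phi2 A R"
      using f(2)[of z] z R by (simp only: Re_avkhadiev_wirths Phi2_def) simp
    moreover have "Re (avkhadiev_wirths A f z) > 0"
      using R' f(1) z \<open>\<not> R' \<le> R\<close> by (simp add: concave_up_to_def)
    ultimately show False using R by simp
  qed
  with R pos show "is_radius_of_concavity class_C_e A R"
    by (simp add: is_radius_of_concavity_def concave_up_to_def)
qed

end
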